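(* Let $S\subset\mathbb F_2^n$ be a public subspace and let $n\ge k$. Every (potentially unbounded) quantum adversary $(\mathcal A_1,\mathcal A_2)$ wins the coset-collapsing game for $S$ and $k$ with advantage at most $2^k/2^n$.
   Context: Coset-collapsing game (for a public subspace $S\subset\mathbb F_2^n$ known to all parties, and an integer $k\le n$), between a challenger and a two-stage adversary $(\mathcal A_1,\mathcal A_2)$: 1. $\mathcal A_1$ outputs a quantum state on two registers $\mathcal R,\mathcal U$, and sends $\mathcal U$ to the challenger and $\mathcal R$ to $\mathcal A_2$. 2. The challenger: (a) samples a random subspace $T\subset S$ with $\dim T=k$; (b) checks in superposition that $\mathcal U$ is supported on $S$ (using the membership oracle of $S$); if the check fails the adversary automatically loses; (c) performs a measurement projecting $\mathcal U$ to a coset of $T$ in $S$, namely $\{\Pi_u\}_{u\in\mathrm{co}(T)}$, where $\mathrm{co}(T)$ is the set of coset representatives of $T$ and $\Pi_u=\sum_{t\in T}|t+u\rangle\langle t+u|$; (d) samples random $b\leftarrow\{0,1\}$; if $b=0$ it does nothing and sends $\mathcal U$ to $\mathcal A_2$; if $b=1$ it measures $\mathcal U$ in the computational basis and then sends it to $\mathcal A_2$. 3. $\mathcal A_2$ outputs a bit $b'$ and wins if $b'=b$. The advantage is the winning probability minus $1/2$.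
   Formalization: Here n is the dimension of the subspace S (which may lie in a larger ambient space F_2^m), not the ambient dimension; with n the ambient dimension the bound fails, e.g. for S={0,s}, k=1, where advantage 1/4 is achievable. *)

theory Defs
  imports "HOL-Probability.Probability" "HOL-Library.Z2"
begin

instance bit :: finite
proof
  have "(UNIV :: bit set) = {0, 1}"
    using bit.exhaust by auto
  then show "finite (UNIV :: bit set)"
    by (metis finite.emptyI finite.insertI)
qed

section \<open>Finite-dimensional quantum states and binary measurements\<close>

text \<open>
  An operator on the Hilbert space with computational basis \<open>'i\<close> is a matrix
  \<^typ>\<open>complex^'i^'i\<close>; the space of two registers with bases \<open>'r\<close> and \<open>'u\<close> has basis
  \<^typ>\<open>'r \<times> 'u\<close>.
\<close>

type_synonym ('r, 'u) joint = "complex^('r \<times> 'u)^('r \<times> 'u)"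

text \<open>Over the complex numbers this condition already implies that the matrix is Hermitian.\<close>

definition psd :: "complex^'i^'i \<Rightarrow> bool" where
  "psd A \<longleftrightarrow> (\<forall>v :: complex^'i. (\<Sum>i\<in>UNIV. \<Sum>j\<in>UNIV. cnj (v $ i) * A $ i $ j * v $ j) \<in> \<real>\<^sub>\<ge>\<^sub>0)"

definition density_operator :: "complex^'i^'i \<Rightarrow> bool" where
  "density_operator \<rho> \<longleftrightarrow> psd \<rho> \<and> trace \<rho> = 1"

text \<open>A two-outcome measurement (POVM); \<open>M b\<close> is the effect of the outcome \<open>b\<close>.\<close>

definition binary_povm :: "(bit \<Rightarrow> complex^'i^'i) \<Rightarrow> bool" where
  "binary_povm M \<longleftrightarrow> (\<forall>b. psd (M b)) \<and> (\<Sum>b\<in>UNIV. M b) = mat 1"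

definition outcome_prob :: "(bit \<Rightarrow> complex^'i^'i) \<Rightarrow> complex^'i^'i \<Rightarrow> bit \<Rightarrow> real" where
  "outcome_prob M \<sigma> b = Re (trace (M b ** \<sigma>))"

text \<open>The projector $|x\rangle\langle x|$.\<close>

definition ketbra :: "'u \<Rightarrow> complex^'u^'u" where
  "ketbra x = (\<chi> i j. if i = x \<and> j = x then 1 else 0)"

text \<open>The operator $I_{\mathcal R} \otimes P$ on the registers $\mathcal R, \mathcal U$.\<close>

definition on_U :: "complex^'u^'u \<Rightarrow> ('r::finite, 'u::finite) joint" where
  "on_U P = (\<chi> i j. if fst i = fst j then P $ snd i $ snd j else 0)"

text \<open>
  The unnormalised state after the outcome of a projective measurement of $\mathcal U$ that belongs
  to the projector \<open>P\<close>; its trace is the trace of \<open>\<rho>\<close> times the probability of that outcome.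
\<close>

definition project_U ::
  "complex^'u^'u \<Rightarrow> ('r::finite, 'u::finite) joint \<Rightarrow> ('r::finite, 'u::finite) joint" where
  "project_U P \<rho> = on_U P ** \<rho> ** on_U P"

section \<open>The coset-collapsing game\<close>

definition subspaces_of :: "(bit^'m) set \<Rightarrow> nat \<Rightarrow> (bit^'m) set set" where
  "subspaces_of S k = {T. vec.subspace T \<and> T \<subseteq> S \<and> vec.dim T = k}"

text \<open>One representative of each coset of \<open>T\<close> in \<open>S\<close>.\<close>

definition co :: "(bit^'m) set \<Rightarrow> (bit^'m) set \<Rightarrow> (bit^'m) set" where
  "co S T = (\<lambda>C. SOME u. u \<in> C) ` {(\<lambda>t. t + s) ` T | s. s \<in> S}"

definition coset_projector :: "(bit^'m) set \<Rightarrow> bit^'m \<Rightarrow> complex^(bit^'m)^(bit^'m)" where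
  "coset_projector T u = (\<Sum>t\<in>T. ketbra (t + u))"

text \<open>
  Only the branch in which the check succeeds is kept, so the trace may drop below \<open>1\<close>. The missing
  weight is the probability that the adversary loses because of a failed check.
\<close>

definition support_check ::
  "(bit^'m) set \<Rightarrow> ('r::finite, bit^'m) joint \<Rightarrow> ('r::finite, bit^'m) joint"
where
  "support_check S \<rho> = project_U (\<Sum>x\<in>S. ketbra x) \<rho>"

text \<open>
  The adversary learns neither the outcome of the coset measurement nor that of the
  computational-basis measurement, so the branches are summed up.
\<close>

definition coset_measurement ::
  "(bit^'m) set \<Rightarrow> (bit^'m) set \<Rightarrow>
    ('r::finite, bit^'m) joint \<Rightarrow> ('r::finite, bit^'m) joint" where
  "coset_measurement S T \<rho> = (\<Sum>u\<in>co S T. project_U (coset_projector T u) \<rho>)"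

definition basis_measurement ::
  "('r::finite, bit^'m) joint \<Rightarrow> ('r::finite, bit^'m) joint" where
  "basis_measurement \<rho> = (\<Sum>x\<in>UNIV. project_U (ketbra x) \<rho>)"

definition challenger ::
  "(bit^'m) set \<Rightarrow> (bit^'m) set \<Rightarrow> bit \<Rightarrow>
    ('r::finite, bit^'m) joint \<Rightarrow> ('r::finite, bit^'m) joint" where
  "challenger S T b \<rho> =
    (let \<sigma> = coset_measurement S T (support_check S \<rho>)
     in if b = 0 then \<sigma> else basis_measurement \<sigma>)"

text \<open>
  The first stage of the adversary is given by the state \<open>\<rho>\<close> on $\mathcal R, \mathcal U$ that it
  prepares, the second stage by the measurement \<open>M\<close> of $\mathcal R, \mathcal U$ that yields its
  guess. The latter does not depend on \<open>T\<close>, which the challenger keeps secret.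
\<close>

definition win_prob ::
  "(bit^'m) set \<Rightarrow> nat \<Rightarrow> ('r::finite, bit^'m) joint \<Rightarrow>
    (bit \<Rightarrow> ('r::finite, bit^'m) joint) \<Rightarrow> real" where
  "win_prob S k \<rho> M =
    measure_pmf.expectation (pmf_of_set (subspaces_of S k)) (\<lambda>T.
      measure_pmf.expectation (pmf_of_set UNIV) (\<lambda>b.
        outcome_prob M (challenger S T b \<rho>) b))"

definition advantage ::
  "(bit^'m) set \<Rightarrow> nat \<Rightarrow> ('r::finite, bit^'m) joint \<Rightarrow>
    (bit \<Rightarrow> ('r::finite, bit^'m) joint) \<Rightarrow> real" where
  "advantage S k \<rho> M = win_prob S k \<rho> M - 1 / 2"

end

theory Submission
  imports Defs
begin

text \<open>
  In the computational basis, the challenger erases the entries \<open>(x, y)\<close> of the state with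
  \<open>x + y \<notin> T\<close> if \<open>b = 0\<close>, and all off-diagonal entries if \<open>b = 1\<close>. By symmetry, each nonzero
  vector of \<open>S\<close> lies in the same fraction \<open>q \<le> 2\<^sup>k / 2\<^sup>n\<close> of the \<open>k\<close>-dimensional subspaces \<open>T\<close>. So the
  average over \<open>T\<close> of the difference of the two states is \<open>q (\<sigma> - D)\<close>, where \<open>\<sigma>\<close> is the checked
  state and \<open>D\<close> its diagonal part. Both are positive semidefinite with trace at most 1, so any
  effect distinguishes them with advantage at most \<open>q\<close>.
\<close>

section \<open>Positive semidefinite matrices and their sesquilinear forms\<close>

definition sesq :: "complex^'i^'i \<Rightarrow> complex^'i \<Rightarrow> complex^'i \<Rightarrow> complex" where
  "sesq A u v = (\<Sum>i\<in>UNIV. \<Sum>j\<in>UNIV. cnj (u $ i) * A $ i $ j * v $ j)"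

lemma psd_iff_sesq: "psd A \<longleftrightarrow> (\<forall>v. sesq A v v \<in> \<real>\<^sub>\<ge>\<^sub>0)"
  by (simp add: psd_def sesq_def)

lemma sesq_add_left: "sesq A (u + v) w = sesq A u w + sesq A v w"
  by (simp add: sesq_def algebra_simps sum.distrib)

lemma sesq_add_right: "sesq A u (v + w) = sesq A u v + sesq A u w"
  by (simp add: sesq_def algebra_simps sum.distrib)

lemma sesq_scale_left: "sesq A (c *s u) v = cnj c * sesq A u v"
  by (simp add: sesq_def sum_distrib_left mult_ac)

lemma sesq_scale_right: "sesq A u (c *s v) = c * sesq A u v"
  by (simp add: sesq_def sum_distrib_left mult_ac)

lemmas sesq_simps = sesq_add_left sesq_add_right sesq_scale_left sesq_scale_right

lemma sesq_axis_left: "sesq A (axis i 1) v = (\<Sum>j\<in>UNIV. A $ i $ j * v $ j)"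
proof -
  have "sesq A (axis i 1) v = (\<Sum>k\<in>UNIV. if k = i then \<Sum>j\<in>UNIV. A $ k $ j * v $ j else 0)"
    unfolding sesq_def by (intro sum.cong) (auto simp: axis_def)
  then show ?thesis by simp
qed

lemma sesq_axis: "sesq A (axis i 1) (axis j 1) = A $ i $ j"
proof -
  have "sesq A (axis i 1) (axis j 1) = (\<Sum>k\<in>UNIV. if k = j then A $ i $ k else 0)"
    unfolding sesq_axis_left by (intro sum.cong) (auto simp: axis_def)
  then show ?thesis by simp
qed

lemma psd_sesq:
  assumes "psd A"
  shows "Im (sesq A v v) = 0" "Re (sesq A v v) \<ge> 0"
  using assms by (auto simp: psd_iff_sesq complex_nonneg_Reals_iff)

lemma psd_diag:
  assumes "psd A"
  shows "Im (A $ i $ i) = 0" "Re (A $ i $ i) \<ge> 0"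
  using psd_sesq[OF assms, of "axis i 1"] by (simp_all add: sesq_axis)

text \<open>Polarisation: the form is real at \<open>u + v\<close>, which makes the imaginary parts
  of the two mixed terms opposite, and real at \<open>u + \<i> *s v\<close>, which makes their real
  parts equal.\<close>

lemma psd_sesq_cnj:
  assumes "psd A"
  shows "sesq A v u = cnj (sesq A u v)"
proof -
  have "Im (sesq A (u + v) (u + v)) = 0" "Im (sesq A (u + \<i> *s v) (u + \<i> *s v)) = 0"
    "Im (sesq A u u) = 0" "Im (sesq A v v) = 0"
    using psd_sesq(1)[OF assms] by blast+
  then show ?thesis
    by (auto simp: sesq_simps complex_eq_iff)
qed

lemma psd_hermitian: "psd A \<Longrightarrow> A $ j $ i = cnj (A $ i $ j)"
  by (metis psd_sesq_cnj sesq_axis)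

lemma psd_zero_diag:
  assumes "psd A" "\<And>i. A $ i $ i = 0"
  shows "A = 0"
proof -
  have "A $ i $ j = 0" for i j
  proof -
    \<comment> \<open>With zero diagonal, the form at e_i + c e_j is c A_ij plus its conjugate; this
      \<open>c\<close> turns it into -2 |A_ij|^2.\<close>
    define c where "c = - cnj (A $ i $ j)"
    have "0 \<le> Re (sesq A (axis i 1 + c *s axis j 1) (axis i 1 + c *s axis j 1))"
      by (rule psd_sesq(2)[OF assms(1)])
    also have "\<dots> = - 2 * (cmod (A $ i $ j))\<^sup>2"
      using psd_hermitian[OF assms(1), of i j] assms(2)
      unfolding sesq_simps sesq_axis c_def cmod_power2 by (simp add: power2_eq_square)
    finally show ?thesis by simp
  qed
  then show ?thesis by (simp add: vec_eq_iff)
qed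

text \<open>One step of a Cholesky decomposition: the \<open>p\<close>-th row and column are split off.\<close>

lemma psd_eliminate:
  fixes A :: "complex^'i^'i"
  assumes "psd A" and nz: "A $ p $ p \<noteq> 0"
  defines "B \<equiv> (\<chi> i j. A $ i $ j - A $ i $ p * A $ p $ j / A $ p $ p)"
  shows "psd B"
  unfolding psd_iff_sesq
proof
  fix v :: "complex^'i"
  let ?a = "A $ p $ p" and ?e = "axis p 1 :: complex^'i"
  define s where "s = sesq A ?e v"
  \<comment> \<open>This \<open>c\<close> minimises the form of \<open>A\<close> at
    \<open>v + c *s ?e\<close>. The minimum is the form of the Schur complement \<open>B\<close> at
    \<open>v\<close>.\<close>
  define c where "c = - s / ?a"
  have vp: "sesq A v ?e = cnj s"
    unfolding s_def by (rule psd_sesq_cnj[OF assms(1)])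
  have s_sum: "s = (\<Sum>j\<in>UNIV. A $ p $ j * v $ j)"
    by (simp add: s_def sesq_axis_left)
  have s_cnj: "cnj s = (\<Sum>i\<in>UNIV. cnj (v $ i) * A $ i $ p)"
    using psd_hermitian[OF assms(1), of _ p] by (simp add: s_sum mult.commute)
  have "sesq B v v = sesq A v v -
      (\<Sum>i\<in>UNIV. \<Sum>j\<in>UNIV. cnj (v $ i) * A $ i $ p * (A $ p $ j * v $ j) / ?a)"
    by (simp add: B_def sesq_def algebra_simps sum_subtractf)
  also have "(\<Sum>i\<in>UNIV. \<Sum>j\<in>UNIV. cnj (v $ i) * A $ i $ p * (A $ p $ j * v $ j) / ?a) =
      cnj s * s / ?a"
    unfolding s_cnj by (simp only: s_sum sum_product sum_divide_distrib)
  finally have "sesq B v v = sesq A v v - cnj s * s / ?a" .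
  also have "\<dots> = sesq A v v + c * cnj s"
    by (simp add: c_def)
  \<comment> \<open>The two new terms cancel, since \<open>s + c * ?a = 0\<close>.\<close>
  also have "\<dots> = sesq A v v + c * cnj s + cnj c * s + cnj c * (c * ?a)"
    using nz by (simp add: c_def)
  also have "\<dots> = sesq A (v + c *s ?e) (v + c *s ?e)"
    unfolding sesq_simps sesq_axis vp s_def[symmetric] by (simp add: algebra_simps)
  finally show "sesq B v v \<in> \<real>\<^sub>\<ge>\<^sub>0"
    using assms(1) by (simp add: psd_iff_sesq)
qed

lemma trace_mult_eq: "trace (A ** B) = (\<Sum>i\<in>UNIV. \<Sum>j\<in>UNIV. A $ i $ j * B $ j $ i)"
  by (simp add: trace_def matrix_matrix_mult_def)

text \<open>Repeated elimination writes \<open>A\<close> as a sum of positive rank-one matrices, and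
  each of them contributes a nonnegative multiple of a value of the form of \<open>M\<close>. The
  induction is on the number of nonzero diagonal entries. The result makes outcome probabilities
  nonnegative.\<close>

lemma psd_trace_mult_nonneg:
  fixes A M :: "complex^'i^'i"
  assumes "psd M" "psd A"
  shows "Re (trace (M ** A)) \<ge> 0"
  using assms(2)
proof (induction "card {i. A $ i $ i \<noteq> 0}" arbitrary: A rule: less_induct)
  case less
  note A = less.prems
  show ?case
  proof (cases "\<exists>p. A $ p $ p \<noteq> 0")
    case False
    then have "A = 0" using psd_zero_diag[OF A] by blast
    then show ?thesis by (simp add: trace_def)
  next
    case True
    then obtain p where p: "A $ p $ p \<noteq> 0" by blast
    let ?a = "A $ p $ p"
    define B where "B = (\<chi> i j. A $ i $ j - A $ i $ p * A $ p $ j / ?a)"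
    have B: "psd B" unfolding B_def by (rule psd_eliminate[OF A p])
    have a: "Im ?a = 0" "Re ?a > 0"
      using psd_diag[OF A, of p] p by (auto simp: complex_eq_iff)
    define r where "r = Re ?a"
    have ar: "?a = of_real r" using a by (simp add: r_def complex_eq_iff)
    \<comment> \<open>Elimination creates no new nonzero diagonal entry: \<open>B $ i $ i\<close>
      would be -|A_pi|^2 / r, and positivity of \<open>B\<close> then forces A_pi = 0. Since the
      entry at \<open>p\<close> vanishes, the induction measure drops.\<close>
    have zero: "B $ i $ i = 0" if "A $ i $ i = 0" for i
    proof -
      have "A $ i $ p * A $ p $ i = of_real ((cmod (A $ p $ i))\<^sup>2)"
        using psd_hermitian[OF A, of i p] by (simp only: complex_norm_square mult.commute)
      then have "B $ i $ i = of_real (- ((cmod (A $ p $ i))\<^sup>2 / r))"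
        using that by (simp add: B_def ar)
      moreover have "Re (B $ i $ i) \<ge> 0" using psd_diag(2)[OF B] .
      ultimately have "(cmod (A $ p $ i))\<^sup>2 / r \<le> 0" by simp
      then have "A $ p $ i = 0" using a by (simp add: r_def divide_le_0_iff)
      then show ?thesis using that by (simp add: B_def)
    qed
    have "B $ p $ p = 0" using p by (simp add: B_def)
    then have "{i. B $ i $ i \<noteq> 0} \<subset> {i. A $ i $ i \<noteq> 0}"
      using zero p by blast
    then have "card {i. B $ i $ i \<noteq> 0} < card {i. A $ i $ i \<noteq> 0}"
      by (intro psubset_card_mono) auto
    from less.hyps[OF this B] have IH: "Re (trace (M ** B)) \<ge> 0" .
    \<comment> \<open>\<open>A - B\<close> is the rank-one matrix with entries w_i cnj(w_j) / a,
      where \<open>w\<close> is the \<open>p\<close>-th column of \<open>A\<close>.\<close>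
    define w where "w = (\<chi> i. A $ i $ p)"
    have "M $ i $ j * A $ j $ i = M $ i $ j * B $ j $ i + cnj (w $ i) * M $ i $ j * w $ j / ?a"
      for i j
      unfolding w_def B_def vec_lambda_beta psd_hermitian[OF A, of p i]
      by (simp add: right_diff_distrib)
    then have "trace (M ** A) = trace (M ** B) + sesq M w w / ?a"
      by (simp only: trace_mult_eq sesq_def sum.distrib sum_divide_distrib)
    moreover have "Re (sesq M w w / ?a) \<ge> 0"
      using psd_sesq(2)[OF assms(1), of w] a
      unfolding ar Re_divide_of_real by (simp add: r_def)
    ultimately show ?thesis using IH by simp
  qed
qed

lemma psd_sum:
  assumes "\<And>x. x \<in> X \<Longrightarrow> psd (f x)"
  shows "psd (\<Sum>x\<in>X. f x)"
proof -
  have 0: "psd (0 :: complex^'i^'i)" by (simp add: psd_def)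
  have add: "psd (A + B)" if "psd A" "psd B" for A B :: "complex^'i^'i"
    using that by (simp add: psd_def algebra_simps sum.distrib nonneg_Reals_add_I)
  show ?thesis
    using assms by (induction X rule: infinite_finite_induct) (auto intro: 0 add)
qed

lemma matrix_eqI: "(\<And>i j. A $ i $ j = B $ i $ j) \<Longrightarrow> A = B"
  by (simp add: vec_eq_iff)

section \<open>Post-measurement states\<close>

text \<open>
  All measurements of the challenger are diagonal in the computational basis, so each of them just
  erases some of the matrix entries of the state.
\<close>

definition restrict_U ::
  "('u \<Rightarrow> 'u \<Rightarrow> bool) \<Rightarrow> ('r::finite, 'u::finite) joint \<Rightarrow> ('r, 'u) joint" where
  "restrict_U R \<rho> = (\<chi> i j. if R (snd i) (snd j) then \<rho> $ i $ j else 0)"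

lemma restrict_U_restrict_U:
  "restrict_U P (restrict_U R \<rho>) = restrict_U (\<lambda>x y. P x y \<and> R x y) \<rho>"
  by (simp add: restrict_U_def vec_eq_iff)

text \<open>The projector is a diagonal 0/1 matrix, so the left factor erases rows and the right
  factor erases columns.\<close>

lemma project_U_eq_restrict_U:
  "project_U (\<Sum>x\<in>X. ketbra x) \<rho> = restrict_U (\<lambda>x y. x \<in> X \<and> y \<in> X) \<rho>"
proof -
  let ?P = "on_U (\<Sum>x\<in>X. ketbra x)"
  have P: "?P $ i $ j = (if i = j then if snd i \<in> X then 1 else 0 else 0)" for i j
  proof (cases "i = j")
    case True
    have "(\<Sum>x\<in>X. ketbra x $ snd i $ snd i :: complex) = (\<Sum>x\<in>X. if x = snd i then 1 else 0)"
      by (intro sum.cong) (auto simp: ketbra_def)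
    then show ?thesis using True by (simp add: on_U_def)
  next
    case False
    then show ?thesis
      by (auto simp: on_U_def ketbra_def prod_eq_iff intro!: sum.neutral)
  qed
  have left: "(?P ** A) $ i $ j = (if snd i \<in> X then A $ i $ j else 0)" for A i j
  proof -
    have "(?P ** A) $ i $ j = (\<Sum>k\<in>UNIV. if k = i then if snd i \<in> X then A $ i $ j else 0 else 0)"
      unfolding matrix_matrix_mult_def vec_lambda_beta by (intro sum.cong refl) (simp add: P)
    then show ?thesis by simp
  qed
  have right: "(A ** ?P) $ i $ j = (if snd j \<in> X then A $ i $ j else 0)" for A i j
  proof -
    have "(A ** ?P) $ i $ j = (\<Sum>k\<in>UNIV. if k = j then if snd j \<in> X then A $ i $ j else 0 else 0)"
      unfolding matrix_matrix_mult_def vec_lambda_beta by (intro sum.cong refl) (simp add: P)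
    then show ?thesis by simp
  qed
  show ?thesis
    by (rule matrix_eqI) (simp add: project_U_def left right restrict_U_def)
qed

lemma project_U_ketbra: "project_U (ketbra x) \<rho> = restrict_U (\<lambda>y z. y = x \<and> z = x) \<rho>"
  using project_U_eq_restrict_U[of "{x}" \<rho>] by simp

text \<open>For a pattern of product shape, erasing entries amounts to truncating the vector at
  which the form is evaluated.\<close>

lemma psd_restrict_U:
  fixes \<rho> :: "('r::finite, 'u::finite) joint"
  assumes "psd \<rho>"
  shows "psd (restrict_U (\<lambda>x y. x \<in> X \<and> y \<in> X) \<rho>)"
  unfolding psd_iff_sesq
proof
  fix v :: "complex^('r \<times> 'u)"
  define w where "w = (\<chi> i. if snd i \<in> X then v $ i else 0)"
  have "sesq (restrict_U (\<lambda>x y. x \<in> X \<and> y \<in> X) \<rho>) v v = sesq \<rho> w w"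
    unfolding sesq_def by (intro sum.cong) (auto simp: restrict_U_def w_def)
  then show "sesq (restrict_U (\<lambda>x y. x \<in> X \<and> y \<in> X) \<rho>) v v \<in> \<real>\<^sub>\<ge>\<^sub>0"
    using assms by (simp add: psd_iff_sesq)
qed

lemma basis_measurement_eq: "basis_measurement \<rho> = restrict_U (=) \<rho>"
proof (rule matrix_eqI)
  fix i j
  have "basis_measurement \<rho> $ i $ j =
      (\<Sum>x\<in>UNIV. if x = snd i then if snd i = snd j then \<rho> $ i $ j else 0 else 0)"
    unfolding basis_measurement_def project_U_ketbra sum_component
    by (intro sum.cong) (auto simp: restrict_U_def)
  then show "basis_measurement \<rho> $ i $ j = restrict_U (=) \<rho> $ i $ j"
    by (simp add: restrict_U_def)
qed

text \<open>The pattern \<open>(=)\<close> is not of product shape in general, but the pattern of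
  each measurement branch is.\<close>

lemma psd_basis_measurement: "psd \<rho> \<Longrightarrow> psd (basis_measurement \<rho>)"
  unfolding basis_measurement_def project_U_ketbra
  by (rule psd_sum) (use psd_restrict_U[where X = "{_}"] in simp)

lemma trace_basis_measurement: "trace (basis_measurement \<rho>) = trace \<rho>"
  by (simp add: basis_measurement_eq trace_def restrict_U_def)

lemma trace_restrict_U_le:
  assumes "psd \<rho>"
  shows "Re (trace (restrict_U P \<rho>)) \<le> Re (trace \<rho>)"
  using psd_diag(2)[OF assms] by (auto simp: trace_def restrict_U_def intro!: sum_mono)

section \<open>Cosets in characteristic 2 and the states sent by the challenger\<close>

lemma bit_vec_diff: "x - y = x + (y :: bit^'m)"
  by (simp add: vec_eq_iff)

lemma bit_vec_add_self: "x + x = (0 :: bit^'m)"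
  by (simp add: vec_eq_iff)

lemma bit_vec_add_add_self: "x + (x + y) = (y :: bit^'m)" "x + y + y = (x :: bit^'m)"
  by (simp_all add: bit_vec_add_self add.assoc flip: add.assoc[of x x])

lemma mem_coset_iff: "x \<in> (\<lambda>t. t + u) ` T \<longleftrightarrow> x + u \<in> T" for x u :: "bit^'m"
  by (metis (no_types, lifting) bit_vec_add_add_self(2) image_iff)

lemma coset_eq_iff:
  fixes u v :: "bit^'m"
  assumes "vec.subspace T"
  shows "(\<lambda>t. t + u) ` T = (\<lambda>t. t + v) ` T \<longleftrightarrow> u + v \<in> T"
proof
  assume "(\<lambda>t. t + u) ` T = (\<lambda>t. t + v) ` T"
  moreover have "u \<in> (\<lambda>t. t + u) ` T"
    using vec.subspace_0[OF assms] by (simp add: mem_coset_iff bit_vec_add_self)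
  ultimately show "u + v \<in> T" by (simp add: mem_coset_iff)
next
  assume uv: "u + v \<in> T"
  have "x + u \<in> T \<longleftrightarrow> x + v \<in> T" for x
  proof -
    have "x + u + (u + v) = x + v" "x + v + (u + v) = x + u"
      by (simp_all add: vec_eq_iff add_ac)
    then show ?thesis using vec.subspace_add[OF assms _ uv] by metis
  qed
  then show "(\<lambda>t. t + u) ` T = (\<lambda>t. t + v) ` T"
    by (auto simp: set_eq_iff mem_coset_iff)
qed

text \<open>The chosen representative depends only on the coset, so vectors of one coset share it.
  Hence the sum over measurement outcomes collapses to a single term in
  \<open>coset_measurement_eq\<close>.\<close>

lemma co_coset:
  assumes T: "vec.subspace T" and x: "x \<in> S"
  shows "{u \<in> co S T. x + u \<in> T} = {SOME u. u \<in> (\<lambda>t. t + x) ` T}"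
proof -
  define r where "r = (\<lambda>C :: (bit^'a) set. SOME u. u \<in> C)"
  have r: "s + r ((\<lambda>t. t + s) ` T) \<in> T" for s
  proof -
    have "s \<in> (\<lambda>t. t + s) ` T"
      using vec.subspace_0[OF T] by (simp add: mem_coset_iff bit_vec_add_self)
    then have "r ((\<lambda>t. t + s) ` T) \<in> (\<lambda>t. t + s) ` T"
      unfolding r_def by (rule someI)
    then show ?thesis by (simp add: mem_coset_iff add.commute)
  qed
  have "r ((\<lambda>t. t + s) ` T) = r ((\<lambda>t. t + x) ` T)" if "x + r ((\<lambda>t. t + s) ` T) \<in> T" for s
    using that r coset_eq_iff[OF T] by metis
  then have "{u \<in> co S T. x + u \<in> T} = {r ((\<lambda>t. t + x) ` T)}"
    using r[of x] x unfolding co_def r_def[symmetric] by blast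
  then show ?thesis by (simp add: r_def)
qed

lemma coset_projector_eq: "coset_projector T u = (\<Sum>x\<in>(\<lambda>t. t + u) ` T. ketbra x)"
  unfolding coset_projector_def by (subst sum.reindex) (auto simp: inj_on_def)

lemma coset_measurement_eq:
  assumes T: "vec.subspace T" and S: "vec.subspace S" "T \<subseteq> S"
  shows "coset_measurement S T (support_check S \<rho>) =
    restrict_U (\<lambda>x y. x \<in> S \<and> y \<in> S \<and> x + y \<in> T) \<rho>"
proof -
  \<comment> \<open>Only the outcome whose coset contains \<open>x\<close> can keep the entry
    \<open>(x, y)\<close>, and it does so iff \<open>y\<close> lies in the same coset.\<close>
  have count: "(\<Sum>u\<in>co S T. if x + u \<in> T \<and> y + u \<in> T then (c::complex) else 0) =
      (if x + y \<in> T then c else 0)" if "x \<in> S" for x y c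
  proof -
    let ?r = "SOME u. u \<in> (\<lambda>t. t + x) ` T"
    note C = co_coset[OF T that]
    have xy: "y + u \<in> T \<longleftrightarrow> x + y \<in> T" if "x + u \<in> T" for u
    proof -
      have "x + u + (y + u) = x + y" "x + u + (x + y) = y + u"
        by (simp_all add: vec_eq_iff add_ac)
      then show ?thesis using vec.subspace_add[OF T that] by metis
    qed
    have "(\<Sum>u\<in>co S T. if x + u \<in> T \<and> y + u \<in> T then c else 0) =
        (\<Sum>u\<in>{u \<in> co S T. x + u \<in> T}. if x + y \<in> T then c else 0)"
      by (subst sum.inter_filter, simp, intro sum.cong refl, use xy in auto)
    also have "\<dots> = (if x + y \<in> T then c else 0)"
      by (simp only: C) simp
    finally show ?thesis .
  qed
  have "coset_measurement S T (support_check S \<rho>) =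
      (\<Sum>u\<in>co S T. restrict_U
        (\<lambda>x y. (x + u \<in> T \<and> y + u \<in> T) \<and> x \<in> S \<and> y \<in> S) \<rho>)"
    unfolding coset_measurement_def support_check_def project_U_eq_restrict_U coset_projector_eq
      restrict_U_restrict_U mem_coset_iff ..
  also have "\<dots> = restrict_U (\<lambda>x y. x \<in> S \<and> y \<in> S \<and> x + y \<in> T) \<rho>"
  proof (rule matrix_eqI)
    fix i j
    show "(\<Sum>u\<in>co S T. restrict_U
        (\<lambda>x y. (x + u \<in> T \<and> y + u \<in> T) \<and> x \<in> S \<and> y \<in> S) \<rho>) $ i $ j =
        restrict_U (\<lambda>x y. x \<in> S \<and> y \<in> S \<and> x + y \<in> T) \<rho> $ i $ j"
      using count[of "snd i" "snd j" "\<rho> $ i $ j"]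
      by (cases "snd i \<in> S \<and> snd j \<in> S")
        (auto simp: sum_component restrict_U_def intro!: sum.neutral)
  qed
  finally show ?thesis .
qed

lemma challenger_0:
  assumes "vec.subspace S" "T \<in> subspaces_of S k"
  shows "challenger S T 0 \<rho> = restrict_U (\<lambda>x y. x \<in> S \<and> y \<in> S \<and> x + y \<in> T) \<rho>"
  using assms by (simp add: challenger_def subspaces_of_def coset_measurement_eq)

text \<open>Since \<open>0 \<in> T\<close>, the coset measurement leaves the diagonal intact, and
  the basis measurement erases the rest. So the state for \<open>b = 1\<close> does not depend on
  \<open>T\<close>.\<close>

lemma challenger_1:
  assumes "vec.subspace S" "T \<in> subspaces_of S k"
  shows "challenger S T 1 \<rho> = basis_measurement (support_check S \<rho>)"
proof -
  have T: "vec.subspace T" "T \<subseteq> S" using assms(2) by (auto simp: subspaces_of_def)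
  have "challenger S T 1 \<rho> =
      restrict_U (\<lambda>x y. x = y \<and> x \<in> S \<and> y \<in> S \<and> x + y \<in> T) \<rho>"
    by (simp add: challenger_def coset_measurement_eq[OF T(1) assms(1) T(2)] basis_measurement_eq
        restrict_U_restrict_U)
  also have "\<dots> = restrict_U (\<lambda>x y. x = y \<and> x \<in> S \<and> y \<in> S) \<rho>"
    using vec.subspace_0[OF T(1)]
    by (intro arg_cong[of _ _ "\<lambda>R. restrict_U R \<rho>"] ext) (auto simp: bit_vec_add_self)
  finally show ?thesis
    by (simp add: basis_measurement_eq support_check_def project_U_eq_restrict_U
        restrict_U_restrict_U)
qed

section \<open>Counting subspaces\<close>

text \<open>The only scalars are 0 and 1, so a further independent vector \<open>a\<close> extends a
  span \<open>V\<close> to the disjoint union of \<open>V\<close> and \<open>V + a\<close>, doubling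
  its size.\<close>

lemma card_span_bit:
  fixes B :: "(bit^'m) set"
  assumes "vec.independent B"
  shows "card (vec.span B) = 2 ^ card B"
proof -
  have "finite B" by simp
  then show ?thesis using assms
  proof (induction B rule: finite_induct)
    case empty
    then show ?case by simp
  next
    case (insert a B)
    let ?V = "vec.span B"
    have a: "a \<notin> ?V" and B: "vec.independent B"
      using insert by (simp_all add: vec.independent_insert)
    have "vec.span (insert a B) = ?V \<union> (\<lambda>t. t + a) ` ?V"
    proof (intro set_eqI iffI)
      fix x assume "x \<in> vec.span (insert a B)"
      then obtain c where c: "x - c *s a \<in> ?V" by (auto simp: vec.span_insert)
      show "x \<in> ?V \<union> (\<lambda>t. t + a) ` ?V"
        using c by (cases c) (auto simp: mem_coset_iff bit_vec_diff)
    next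
      fix x assume "x \<in> ?V \<union> (\<lambda>t. t + a) ` ?V"
      then have "x - 0 *s a \<in> ?V \<or> x - 1 *s a \<in> ?V"
        by (auto simp: mem_coset_iff bit_vec_diff)
      then show "x \<in> vec.span (insert a B)" unfolding vec.span_insert by blast
    qed
    moreover have "?V \<inter> (\<lambda>t. t + a) ` ?V = {}"
    proof -
      have "a \<in> ?V" if "x \<in> ?V" "x + a \<in> ?V" for x
        using vec.span_add[OF that] by (simp add: bit_vec_add_add_self)
      then show ?thesis using a by (auto simp: mem_coset_iff)
    qed
    moreover have "card ((\<lambda>t. t + a) ` ?V) = card ?V"
      by (intro card_image) (auto simp: inj_on_def)
    ultimately show ?case
      using insert.IH[OF B] insert.hyps by (simp add: card_Un_disjoint)
  qed
qed

lemma card_bit_subspace: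
  fixes T :: "(bit^'m) set"
  assumes "vec.subspace T"
  shows "card T = 2 ^ vec.dim T"
proof -
  obtain B where B: "B \<subseteq> T" "vec.independent B" "T \<subseteq> vec.span B" "card B = vec.dim T"
    using vec.basis_exists by blast
  then have "vec.span B = T" using assms vec.span_subspace by blast
  then show ?thesis using card_span_bit[OF B(2)] B(4) by simp
qed

text \<open>Any \<open>k\<close> vectors of a basis of \<open>S\<close> span such a subspace. This
  makes the uniform choice of \<open>T\<close> meaningful.\<close>

lemma subspaces_of_nonempty:
  assumes "vec.subspace S" "k \<le> vec.dim S"
  shows "subspaces_of S k \<noteq> {}"
proof -
  obtain B where B: "B \<subseteq> S" "vec.independent B" "S \<subseteq> vec.span B" "card B = vec.dim S"
    using vec.basis_exists by blast
  obtain C where C: "C \<subseteq> B" "card C = k"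
    using obtain_subset_with_card_n assms(2) B(4) by metis
  have "vec.independent C" using vec.independent_mono B(2) C(1) by blast
  then have "vec.dim (vec.span C) = k"
    using C(2) vec.dim_eq_card_independent by (simp only: vec.dim_span) blast
  moreover have "vec.span C \<subseteq> S"
    using B(1) C(1) assms(1) by (intro vec.span_minimal) auto
  ultimately have "vec.span C \<in> subspaces_of S k"
    by (simp add: subspaces_of_def vec.subspace_span)
  then show ?thesis by blast
qed

text \<open>A coordinate that is 1 on both vectors serves. Otherwise the sum of two coordinates
  does, one being 1 only on \<open>z\<close> and the other only on \<open>w\<close>.\<close>

lemma bit_functional_exists:
  fixes z w :: "bit^'m"
  assumes "z \<noteq> 0" "w \<noteq> 0"
  shows "\<exists>f :: bit^'m \<Rightarrow> bit. (\<forall>x y. f (x + y) = f x + f y) \<and> f z = 1 \<and> f w = 1"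
proof -
  obtain i j where ij: "z $ i = 1" "w $ j = 1"
    using assms by (auto simp: vec_eq_iff)
  show ?thesis
  proof (cases "w $ i = 1 \<or> z $ j = 1")
    case True
    then show ?thesis
      using ij by (elim disjE) (rule exI[of _ "\<lambda>x. x $ i"] exI[of _ "\<lambda>x. x $ j"], simp)+
  next
    case False
    then have "w $ i = 0" "z $ j = 0" using bit.exhaust by blast+
    then show ?thesis
      using ij by (intro exI[of _ "\<lambda>x. x $ i + x $ j"])
        (simp only: simp_thms vector_add_component add_ac add_0_left add_0_right)
  qed
qed

text \<open>
  The transvection \<open>x \<mapsto> x + f x (z + w)\<close> with \<open>f z = f w = 1\<close> is a linear involution that
  preserves \<open>S\<close> and exchanges \<open>z\<close> and \<open>w\<close>.
\<close>

lemma card_subspaces_containing_le: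
  fixes S :: "(bit^'m) set"
  assumes S: "vec.subspace S" and z: "z \<in> S" "z \<noteq> 0" and w: "w \<in> S" "w \<noteq> 0"
  shows "card {T \<in> subspaces_of S k. z \<in> T} \<le> card {T \<in> subspaces_of S k. w \<in> T}"
proof -
  obtain f :: "bit^'m \<Rightarrow> bit" where f: "\<And>x y. f (x + y) = f x + f y" "f z = 1" "f w = 1"
    using bit_functional_exists[OF z(2) w(2)] by blast
  define L where "L x = x + f x *s (z + w)" for x
  have f0: "f 0 = 0" using f(1)[of 0 0] by simp
  \<comment> \<open>\<open>f (z + w) = 1 + 1 = 0\<close>, so \<open>L\<close> leaves
    \<open>f\<close> unchanged and applying \<open>L\<close> twice adds the same vector
    twice.\<close>
  have fzw: "f (c *s (z + w)) = 0" for c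
    using f by (cases c) (simp_all add: f0)
  have fL: "f (L x) = f x" for x
    by (simp only: L_def f(1) fzw add_0_right)
  have LL: "L (L x) = x" for x
    unfolding L_def[of "L x"] fL by (simp only: L_def bit_vec_add_add_self)
  have Lz: "L z = w" by (simp add: L_def f(2) bit_vec_add_add_self)
  have L_add: "L (x + y) = L x + L y" for x y
    by (simp only: L_def f(1) vec.scale_left_distrib add_ac)
  have L_scale: "L (c *s x) = c *s L x" for c x
    by (cases c) (simp_all add: L_def f0)
  have lin: "Vector_Spaces.linear (*s) (*s) L"
    by (rule Vector_Spaces.linear_iff[THEN iffD2])
      (simp add: L_add L_scale vec.vector_space_axioms)
  have LS: "L x \<in> S" if "x \<in> S" for x
    unfolding L_def using that z w S by (intro vec.subspace_add vec.subspace_scale)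
  have inj: "inj L" by (metis LL injI)
  have "L ` T \<in> subspaces_of S k" if T: "T \<in> subspaces_of S k" for T
  proof -
    have T: "vec.subspace T" "T \<subseteq> S" "vec.dim T = k" using T by (auto simp: subspaces_of_def)
    have sub: "vec.subspace (L ` T)"
      using vec.linear_subspace_image[OF lin T(1)] .
    \<comment> \<open>Over F_2 the cardinality determines the dimension, so injectivity of
      \<open>L\<close> is enough.\<close>
    have "card (L ` T) = card T" using inj by (simp add: card_image inj_on_subset)
    then have "vec.dim (L ` T) = k"
      using card_bit_subspace[OF sub] card_bit_subspace[OF T(1)] T(3) by simp
    then show ?thesis using sub T LS by (auto simp: subspaces_of_def)
  qed
  moreover have "w \<in> L ` T" if "z \<in> T" for T using that Lz by blast
  moreover have "inj ((`) L)" by (meson inj inj_image_eq_iff injI)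
  ultimately show ?thesis
    by (intro card_inj_on_le[of "(`) L"]) (auto intro: inj_on_subset)
qed

text \<open>Double counting of the pairs of a nonzero vector \<open>z\<close> and a subspace \<open>T\<close> with \<open>z \<in> T\<close>.\<close>

lemma card_subspaces_containing:
  fixes S :: "(bit^'m) set"
  assumes S: "vec.subspace S" and k: "k \<le> vec.dim S"
  obtains Q where "\<And>z. \<lbrakk>z \<in> S; z \<noteq> 0\<rbrakk> \<Longrightarrow> card {T \<in> subspaces_of S k. z \<in> T} = Q"
    and "Q * 2 ^ vec.dim S \<le> card (subspaces_of S k) * 2 ^ k"
proof (cases "S - {0} = {}")
  case True
  \<comment> \<open>For the zero space the first condition is vacuous, so \<open>Q = 0\<close>
    works.\<close>
  then show ?thesis using that[of 0] by auto
next
  case False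
  then obtain w where w: "w \<in> S" "w \<noteq> 0" by blast
  let ?N = "\<lambda>z. card {T \<in> subspaces_of S k. z \<in> T}"
  \<comment> \<open>The inequality is applied twice, with the two vectors exchanged.\<close>
  have eq: "?N z = ?N w" if "z \<in> S" "z \<noteq> 0" for z
    using card_subspaces_containing_le[OF S] that w by (simp add: le_antisym)
  have S0: "0 \<in> S" using S vec.subspace_0 by blast
  have "(2 ^ vec.dim S - 1) * ?N w = (\<Sum>z\<in>S - {0}. ?N z)"
    using S0 by (simp add: eq card_Diff_singleton card_bit_subspace[OF S])
  also have "\<dots> = (\<Sum>z\<in>S - {0}. \<Sum>T\<in>subspaces_of S k. if z \<in> T then 1 else 0)"
    by (simp add: sum.If_cases Int_def)
  also have "\<dots> = (\<Sum>T\<in>subspaces_of S k. \<Sum>z\<in>S - {0}. if z \<in> T then 1 else 0)"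
    by (rule sum.swap)
  also have "\<dots> = (\<Sum>T\<in>subspaces_of S k. 2 ^ k - 1)"
  proof (rule sum.cong[OF refl])
    fix T assume "T \<in> subspaces_of S k"
    then have T: "vec.subspace T" "T \<subseteq> S" "vec.dim T = k" by (auto simp: subspaces_of_def)
    have "(\<Sum>z\<in>S - {0}. if z \<in> T then 1 else 0) = card (T - {0})"
      using T(2) by (auto simp: sum.If_cases intro!: arg_cong[of _ _ card])
    also have "\<dots> = 2 ^ k - 1"
      using T vec.subspace_0[OF T(1)] by (simp add: card_bit_subspace)
    finally show "(\<Sum>z\<in>S - {0}. if z \<in> T then 1 else 0) = (2 ^ k - 1 :: nat)" .
  qed
  finally have *: "(2 ^ vec.dim S - 1) * ?N w = card (subspaces_of S k) * (2 ^ k - 1)" by simp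
  \<comment> \<open>Turns the exact fraction (2^k - 1) / (2^n - 1), with n the dimension of
    \<open>S\<close>, into the bound 2^k / 2^n:
    \<open>a * c = b * (d - 1) + a \<le> b * d\<close>.\<close>
  have aux: "a * c \<le> b * d" if "(c - 1) * a = b * (d - 1)" "a \<le> b" "c > 0" "d > 0" for a b c d :: nat
    using that by (cases c; cases d) (simp_all add: mult.commute)
  have "?N w \<le> card (subspaces_of S k)" by (rule card_mono) auto
  then have "?N w * 2 ^ vec.dim S \<le> card (subspaces_of S k) * 2 ^ k"
    using aux[OF *] by simp
  then show ?thesis using that eq by blast
qed

section \<open>The advantage\<close>

text \<open>As \<open>M\<close> is independent of \<open>T\<close>, linearity lets the sum over
  \<open>T\<close> be taken on the states before measuring.\<close>

lemma linear_outcome_prob: "linear (\<lambda>\<sigma>. outcome_prob M \<sigma> b)"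
  by (rule linearI)
    (simp_all add: outcome_prob_def trace_mult_eq algebra_simps sum.distrib sum_distrib_left)

lemma UNIV_bit: "(UNIV :: bit set) = {0, 1}"
  using bit.exhaust by auto

lemma outcome_prob_add_eq_trace:
  assumes "binary_povm M"
  shows "outcome_prob M \<sigma> 0 + outcome_prob M \<sigma> 1 = Re (trace \<sigma>)"
proof -
  have "M 0 + M 1 = mat 1" using assms by (simp add: binary_povm_def UNIV_bit)
  then have "trace ((M 0 + M 1) ** \<sigma>) = trace \<sigma>" by simp
  then have "trace (M 0 ** \<sigma>) + trace (M 1 ** \<sigma>) = trace \<sigma>"
    by (simp add: trace_mult_eq algebra_simps sum.distrib)
  then show ?thesis by (simp add: outcome_prob_def flip: plus_complex.sel)
qed

lemma outcome_prob_nonneg: "\<lbrakk>binary_povm M; psd \<sigma>\<rbrakk> \<Longrightarrow> outcome_prob M \<sigma> b \<ge> 0"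
  by (simp add: outcome_prob_def binary_povm_def psd_trace_mult_nonneg)

text \<open>Entrywise: an off-diagonal entry \<open>(x, y)\<close> inside \<open>S\<close> survives
  for exactly the \<open>Q\<close> subspaces that contain the nonzero vector \<open>x + y\<close>.
  Diagonal entries cancel for every \<open>T\<close>, and entries outside \<open>S\<close>
  vanish.\<close>

lemma sum_challenger_diff:
  fixes S :: "(bit^'m) set" and \<rho> :: "('r::finite, bit^'m) joint"
  assumes S: "vec.subspace S"
    and Q: "\<And>z. \<lbrakk>z \<in> S; z \<noteq> 0\<rbrakk> \<Longrightarrow> card {T \<in> subspaces_of S k. z \<in> T} = Q"
  shows "(\<Sum>T\<in>subspaces_of S k. challenger S T 0 \<rho> - basis_measurement (support_check S \<rho>)) =
    real Q *\<^sub>R (support_check S \<rho> - basis_measurement (support_check S \<rho>))"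
proof (rule matrix_eqI)
  fix i j :: "'r \<times> (bit^'m)"
  let ?X = "subspaces_of S k"
  let ?D = "basis_measurement (support_check S \<rho>)"
  let ?x = "snd i" and ?y = "snd j"
  have \<sigma>: "support_check S \<rho> $ i $ j = (if ?x \<in> S \<and> ?y \<in> S then \<rho> $ i $ j else 0)"
    by (simp add: support_check_def project_U_eq_restrict_U restrict_U_def)
  have D: "?D $ i $ j = (if ?x = ?y then support_check S \<rho> $ i $ j else 0)"
    by (simp only: basis_measurement_eq restrict_U_def vec_lambda_beta)
  have C: "challenger S T 0 \<rho> $ i $ j =
      (if ?x \<in> S \<and> ?y \<in> S \<and> ?x + ?y \<in> T then \<rho> $ i $ j else 0)"
    if "T \<in> ?X" for T
    by (simp only: challenger_0[OF S that] restrict_U_def vec_lambda_beta)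
  show "(\<Sum>T\<in>?X. challenger S T 0 \<rho> - ?D) $ i $ j =
      (real Q *\<^sub>R (support_check S \<rho> - ?D)) $ i $ j"
  proof (cases "?x \<in> S \<and> ?y \<in> S \<and> ?x \<noteq> ?y")
    case True
    then have S: "?x + ?y \<in> S" "?x + ?y \<noteq> 0"
      using vec.subspace_add[OF S] by (auto simp flip: bit_vec_diff)
    have "(\<Sum>T\<in>?X. challenger S T 0 \<rho> - ?D) $ i $ j =
        (\<Sum>T\<in>?X. if ?x + ?y \<in> T then \<rho> $ i $ j else 0)"
      unfolding sum_component vector_minus_component
      by (intro sum.cong refl) (use True in \<open>simp only: C D, simp\<close>)
    also have "\<dots> = of_nat (card {T \<in> ?X. ?x + ?y \<in> T}) * \<rho> $ i $ j"
      by (simp flip: sum.inter_filter)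
    finally show ?thesis
      unfolding Q[OF S] vector_scaleR_component vector_minus_component
      unfolding scaleR_conv_of_real using True by (simp add: \<sigma> D)
  next
    case False
    have "(challenger S T 0 \<rho> - ?D) $ i $ j = 0" if "T \<in> ?X" for T
    proof -
      have "0 \<in> T" using that by (simp add: subspaces_of_def vec.subspace_0)
      then show ?thesis
        using False bit_vec_add_self[of ?x]
        unfolding vector_minus_component C[OF that] D \<sigma> by auto
    qed
    then have "(\<Sum>T\<in>?X. challenger S T 0 \<rho> - ?D) $ i $ j = 0"
      unfolding sum_component by (intro sum.neutral) blast
    moreover have "support_check S \<rho> $ i $ j = ?D $ i $ j"
      using False unfolding D \<sigma> by auto
    ultimately show ?thesis by simp
  qed
qed

theorem theorem4p27:
  fixes S :: "(bit^'m) set"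
    and n k :: nat
    and \<rho> :: "('r::finite, bit^'m) joint"
    and M :: "bit \<Rightarrow> ('r, bit^'m) joint"
  assumes "vec.subspace S"
    and "vec.dim S = n"
    and "k \<le> n"
    and "density_operator \<rho>"
    and "binary_povm M"
  shows "advantage S k \<rho> M \<le> 2 ^ k / 2 ^ n"
proof -
  let ?X = "subspaces_of S k"
  define N where "N = card ?X"
  define \<sigma> where "\<sigma> = support_check S \<rho>"
  define D where "D = basis_measurement \<sigma>"
  have "k \<le> vec.dim S" using assms(2,3) by simp
  from card_subspaces_containing[OF assms(1) this]
  obtain Q where Q: "\<And>z. \<lbrakk>z \<in> S; z \<noteq> 0\<rbrakk> \<Longrightarrow> card {T \<in> ?X. z \<in> T} = Q"
    and QN: "Q * 2 ^ n \<le> N * 2 ^ k"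
    unfolding assms(2) N_def by blast
  have ne: "?X \<noteq> {}" using subspaces_of_nonempty assms by blast
  then have N: "N > 0" by (simp add: N_def card_gt_0_iff)
  have \<rho>: "psd \<rho>" "Re (trace \<rho>) = 1" using assms(4) by (auto simp: density_operator_def)
  have \<sigma>_eq: "\<sigma> = restrict_U (\<lambda>x y. x \<in> S \<and> y \<in> S) \<rho>"
    by (simp add: \<sigma>_def support_check_def project_U_eq_restrict_U)
  have \<sigma>: "psd \<sigma>" "Re (trace \<sigma>) \<le> 1"
    using psd_restrict_U[OF \<rho>(1)] trace_restrict_U_le[OF \<rho>(1)] \<rho>(2) by (auto simp: \<sigma>_eq)
  have D: "psd D" "trace D = trace \<sigma>"
    unfolding D_def using \<sigma> by (auto simp: psd_basis_measurement trace_basis_measurement)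
  note lin = linear_outcome_prob[of M]
  have mix: "(\<Sum>T\<in>?X. challenger S T 0 \<rho> - D) = real Q *\<^sub>R (\<sigma> - D)"
    unfolding D_def \<sigma>_def using assms(1) Q by (rule sum_challenger_diff)
  \<comment> \<open>For \<open>b = 1\<close> the state is \<open>D\<close>, and its probability of
    guess 1 is its trace minus that of guess 0. This leaves the difference of two states under the
    effect \<open>M 0\<close>.\<close>
  have "(\<Sum>T\<in>?X. \<Sum>b\<in>UNIV. outcome_prob M (challenger S T b \<rho>) b) =
      (\<Sum>T\<in>?X. outcome_prob M (challenger S T 0 \<rho> - D) 0 + Re (trace D))"
    using outcome_prob_add_eq_trace[OF assms(5), of D]
    by (intro sum.cong)
      (simp_all add: UNIV_bit challenger_1[OF assms(1)] linear_diff[OF lin] flip: D_def \<sigma>_def)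
  also have "\<dots> = real Q * (outcome_prob M \<sigma> 0 - outcome_prob M D 0) + N * Re (trace D)"
  proof -
    have "(\<Sum>T\<in>?X. outcome_prob M (challenger S T 0 \<rho> - D) 0) =
        outcome_prob M (real Q *\<^sub>R (\<sigma> - D)) 0"
      unfolding mix[symmetric] by (rule linear_sum[OF lin, symmetric])
    then show ?thesis
      by (simp only: sum.distrib) (simp add: N_def linear_diff[OF lin] linear_cmul[OF lin])
  qed
  also have "\<dots> \<le> real Q * 1 + real N * 1"
  proof (intro add_mono mult_left_mono)
    \<comment> \<open>The first probability is at most the trace of \<open>\<sigma>\<close>, and the
      second is nonnegative.\<close>
    show "outcome_prob M \<sigma> 0 - outcome_prob M D 0 \<le> 1"
      using outcome_prob_nonneg[OF assms(5) \<sigma>(1), of 1] outcome_prob_nonneg[OF assms(5) D(1), of 0]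
        outcome_prob_add_eq_trace[OF assms(5), of \<sigma>] \<sigma>(2) by linarith
  qed (use \<sigma> D in auto)
  finally have total: "(\<Sum>T\<in>?X. \<Sum>b\<in>UNIV. outcome_prob M (challenger S T b \<rho>) b) \<le> Q + N"
    by simp
  have "win_prob S k \<rho> M =
      (\<Sum>T\<in>?X. \<Sum>b\<in>UNIV. outcome_prob M (challenger S T b \<rho>) b) / (2 * N)"
    unfolding win_prob_def using ne
    by (simp add: integral_pmf_of_set N_def UNIV_bit flip: sum_divide_distrib)
  also have "\<dots> \<le> (Q + N) / (2 * N)"
    using total by (intro divide_right_mono) auto
  also have "\<dots> = Q / N / 2 + 1 / 2" using N by (simp add: field_simps)
  \<comment> \<open>The factor 1/2 from the uniform choice of \<open>b\<close> is given away
    here.\<close>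
  also have "\<dots> \<le> Q / N + 1 / 2" using N by (simp add: field_simps)
  finally have "win_prob S k \<rho> M \<le> Q / N + 1 / 2" .
  moreover have "real Q / N \<le> 2 ^ k / 2 ^ n"
  proof -
    have "real Q * 2 ^ n \<le> N * 2 ^ k"
      using of_nat_mono[OF QN, where 'a = real] by simp
    then show ?thesis using N by (simp add: field_simps)
  qed
  ultimately show ?thesis unfolding advantage_def by linarith
qed

end
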